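(* $$N(t)=(e-1)\left(t+\frac{e-2}{2}\right)+o(1).$$
   Context: For real $t\ge 0$, $N(t)$ denotes the expected number of selections when numbers are selected independently and uniformly at random from $[1,e]$ until their product is greater than $e^t$. That is, $N(t)$ is the expected value of $\min\{n\ge 1: Z_1Z_2\cdots Z_n>e^t\}$, where $Z_1,Z_2,\ldots$ are i.i.d. uniform on $[1,e]$. Here $o(1)$ denotes a quantity tending to $0$ as $t\to\infty$. *)

theory Defs
  imports "HOL-Probability.Probability" "HOL-Library.Landau_Symbols"
begin

(* The selections are indexed from 0, so the product of the first n of them runs over k < n.
   If the products never exceed exp t (for uniform selections from [1,e] this has
   probability 0), LEAST is an unspecified number. *)
definition num_selections :: "(nat \<Rightarrow> 'a \<Rightarrow> real) \<Rightarrow> real \<Rightarrow> 'a \<Rightarrow> nat" where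
  "num_selections Z t \<omega> = (LEAST n. n \<ge> 1 \<and> (\<Prod>k<n. Z k \<omega>) > exp t)"

definition expected_selections :: "'a measure \<Rightarrow> (nat \<Rightarrow> 'a \<Rightarrow> real) \<Rightarrow> real \<Rightarrow> real" where
  "expected_selections M Z t = (\<integral>\<omega>. real (num_selections Z t \<omega>) \<partial>M)"

definition iid_uniform :: "'a measure \<Rightarrow> (nat \<Rightarrow> 'a \<Rightarrow> real) \<Rightarrow> real \<Rightarrow> real \<Rightarrow> bool" where
  "iid_uniform M Z a b \<longleftrightarrow>
     prob_space.indep_vars M (\<lambda>_. borel) Z UNIV \<and>
     (\<forall>k. distr M borel (Z k) = uniform_measure lborel {a..b})"

end

theory Submission
  imports Defs
begin

text \<open>
  Taking logarithms, the number of selections is the first passage time above \<open>t\<close> of the random walk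
  \<open>S\<^sub>n = ln Z\<^sub>1 + \<dots> + ln Z\<^sub>n\<close>, whose steps lie in \<open>[0,1]\<close>. Its expectation is the renewal function
  \<open>N t = (\<Sum>n. P (S\<^sub>n \<le> t))\<close>, because the walk is below \<open>t\<close> exactly until it passes \<open>t\<close>.

  For a step law \<open>F\<close> on \<open>[0,1]\<close> the renewal function satisfies two integral identities for \<open>t \<ge> 0\<close>:

  \<^item> \<open>N t = 1 + \<integral> N (t - x) dF x\<close>, by conditioning on one step (\<open>renewal_equation\<close>);

  \<^item> \<open>\<integral>\<^sub>0\<^sup>1 N (t - x) P (X > x) dx = t\<close> (\<open>integral_U_tail\<close>). Here the \<open>n\<close>-th summand of \<open>N\<close> contributes the
    expected length of the part of \<open>[0,t]\<close> covered by the \<open>n\<close>-th step, and the steps cover all of it.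

  The logarithm of a uniform variable on \<open>[1,e]\<close> has density \<open>f x = e\<^sup>x / (e - 1)\<close> and tail
  \<open>G x = (e - e\<^sup>x) / (e - 1)\<close>, and \<open>f\<close> is bounded below by a multiple of \<open>G\<close>: one has
  \<open>f = G / (e - 1) + w\<close> with \<open>w x = e (e\<^sup>x - 1) / (e - 1)\<^sup>2 \<ge> 0\<close> (\<open>density_decomposition\<close>). Inserting this in the
  first identity and evaluating the \<open>G\<close>-part by the second one gives
  \<open>N t = 1 + t / (e - 1) + \<integral>\<^sub>0\<^sup>1 N (t - x) w x dx\<close> (\<open>N_equation\<close>). The affine function
  \<open>(e - 1) (t + (e - 2) / 2)\<close> solves the same equation, so the difference \<open>D\<close> satisfies
  \<open>D t = \<integral>\<^sub>0\<^sup>1 D (t - x) w x dx\<close>.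
  The kernel \<open>w\<close> has total mass \<open>1 - 1 / (e - 1)\<^sup>2 < 1\<close>, so every unit of time shrinks a bound on \<open>\<bar>D\<bar>\<close> by this
  factor. Since \<open>N\<close> is monotone, the second identity also shows that \<open>D\<close> is bounded, and therefore
  \<open>D\<close> tends to \<open>0\<close>, even exponentially fast.
\<close>

section \<open>Renewal identities for steps in the unit interval\<close>

text \<open>
  The last assumption says that the steps have positive mean: for a law on \<open>[0,1]\<close> the integral of the
  tail is the mean. The tail integral is the form in which the mean enters below.
\<close>

locale bounded_renewal = prob_space M
  for M :: "'a measure" +
  fixes X :: "nat \<Rightarrow> 'a \<Rightarrow> real" and F :: "real measure"
  assumes indep: "indep_vars (\<lambda>_. borel) X UNIV"
    and distr_X: "distr M borel (X n) = F"
    and step_range: "AE x in F. 0 \<le> x \<and> x \<le> 1"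
    and mean_pos: "(\<integral>\<^sup>+x\<in>{0..1}. emeasure F {x<..} \<partial>lborel) \<noteq> 0"
begin

definition S :: "nat \<Rightarrow> 'a \<Rightarrow> real" where
  "S n \<omega> = (\<Sum>k<n. X k \<omega>)"

text \<open>
  The renewal function. It is extended-valued because its finiteness is only obtained in \<open>U_finite\<close>.
\<close>

definition U :: "real \<Rightarrow> ennreal" where
  "U t = (\<Sum>n. emeasure M {\<omega>\<in>space M. S n \<omega> \<le> t})"

lemma measurable_X [measurable]: "X n \<in> borel_measurable M"
  using indep by (auto simp: indep_vars_def)

lemma measurable_S [measurable]: "S n \<in> borel_measurable M"
  unfolding S_def by measurable

lemma sets_F [measurable_cong, simp]: "sets F = sets borel"
  using distr_X[of 0] by (metis sets_distr)

lemma prob_space_F: "prob_space F"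
  using prob_space_distr[OF measurable_X[of 0]] by (simp add: distr_X)

lemma AE_step_range: "AE \<omega> in M. 0 \<le> X n \<omega> \<and> X n \<omega> \<le> 1"
  using step_range unfolding distr_X[of n, symmetric] by (subst (asm) AE_distr_iff) auto

lemma AE_S_nonneg: "AE \<omega> in M. 0 \<le> S n \<omega>"
proof -
  have "AE \<omega> in M. \<forall>k. 0 \<le> X k \<omega> \<and> X k \<omega> \<le> 1"
    using AE_step_range by (simp add: AE_all_countable)
  then show ?thesis
    by eventually_elim (auto simp: S_def intro!: sum_nonneg)
qed

lemma indep_X_S: "indep_var borel (X n) borel (S n)"
  unfolding S_def[abs_def]
  by (intro indep_vars_sum indep_vars_subset[OF indep]) auto

lemma measurable_emeasure_S [measurable]:
  "(\<lambda>x. emeasure M {\<omega>\<in>space M. S n \<omega> \<le> x}) \<in> borel_measurable borel"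
proof -
  have "(\<lambda>x. prob {\<omega>\<in>space M. S n \<omega> \<le> x}) \<in> borel_measurable borel"
    by (rule borel_measurable_mono) (auto simp: mono_def intro!: finite_measure_mono)
  then show ?thesis by (simp add: emeasure_eq_measure)
qed

lemma mono_U: "mono U"
  unfolding U_def mono_def by (auto intro!: suminf_le emeasure_mono)

lemma measurable_U [measurable]: "U \<in> borel_measurable borel"
  unfolding U_def by measurable

lemma emeasure_S_Suc:
  "emeasure M {\<omega>\<in>space M. S (Suc n) \<omega> \<le> t} = (\<integral>\<^sup>+x. emeasure M {\<omega>\<in>space M. S n \<omega> \<le> t - x} \<partial>F)"
proof -
  interpret DS: prob_space "distr M borel (S n)" by (rule prob_space_distr) simp
  have eq: "F \<Otimes>\<^sub>M distr M borel (S n) = distr M (borel \<Otimes>\<^sub>M borel) (\<lambda>\<omega>. (X n \<omega>, S n \<omega>))"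
    using indep_X_S[of n] unfolding indep_var_distribution_eq by (simp add: distr_X)
  let ?A = "{p \<in> space (borel \<Otimes>\<^sub>M borel). fst p + snd p \<le> t} :: (real \<times> real) set"
  have A [measurable]: "?A \<in> sets (borel \<Otimes>\<^sub>M borel)"
    by measurable
  have "emeasure M {\<omega>\<in>space M. S (Suc n) \<omega> \<le> t}
      = emeasure (distr M (borel \<Otimes>\<^sub>M borel) (\<lambda>\<omega>. (X n \<omega>, S n \<omega>))) ?A"
    using A by (subst emeasure_distr)
      (auto simp: S_def space_pair_measure add.commute intro!: arg_cong[where f="emeasure M"])
  also have "\<dots> = (\<integral>\<^sup>+x. emeasure (distr M borel (S n)) (Pair x -` ?A) \<partial>F)"
    unfolding eq[symmetric] by (rule DS.emeasure_pair_measure_alt) measurable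
  also have "\<dots> = (\<integral>\<^sup>+x. emeasure M {\<omega>\<in>space M. S n \<omega> \<le> t - x} \<partial>F)"
  proof (rule nn_integral_cong)
    fix x
    have *: "Pair x -` ?A = {..t - x}"
      by (auto simp: space_pair_measure)
    show "emeasure (distr M borel (S n)) (Pair x -` ?A) = emeasure M {\<omega>\<in>space M. S n \<omega> \<le> t - x}"
      unfolding * by (subst emeasure_distr) (auto intro!: arg_cong[where f="emeasure M"])
  qed
  finally show ?thesis .
qed

lemma renewal_equation:
  assumes "0 \<le> t" shows "U t = 1 + (\<integral>\<^sup>+x. U (t - x) \<partial>F)"
proof -
  have "U t = emeasure M {\<omega>\<in>space M. S 0 \<omega> \<le> t} + (\<Sum>n. emeasure M {\<omega>\<in>space M. S (Suc n) \<omega> \<le> t})"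
    using suminf_offset[of "\<lambda>n. emeasure M {\<omega>\<in>space M. S n \<omega> \<le> t}" 1]
    by (simp add: U_def add.commute)
  also have "emeasure M {\<omega>\<in>space M. S 0 \<omega> \<le> t} = 1"
    using assms by (simp add: S_def emeasure_space_1)
  also have "(\<Sum>n. emeasure M {\<omega>\<in>space M. S (Suc n) \<omega> \<le> t}) = (\<integral>\<^sup>+x. U (t - x) \<partial>F)"
    unfolding emeasure_S_Suc U_def by (subst nn_integral_suminf) auto
  finally show ?thesis .
qed

lemma emeasure_X_greater: "emeasure M {\<omega>\<in>space M. x < X n \<omega>} = emeasure F {x<..}"
  unfolding distr_X[of n, symmetric]
  by (subst emeasure_distr) (auto intro!: arg_cong[where f="emeasure M"])

lemma measurable_tail [measurable]: "(\<lambda>x. emeasure F {x<..}) \<in> borel_measurable borel"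
proof -
  interpret DF: prob_space F by (rule prob_space_F)
  have "(\<lambda>x. measure F {x<..}) \<in> borel_measurable borel"
  proof -
    have "mono (\<lambda>x. - measure F {x<..})"
      by (auto simp: mono_def intro!: DF.finite_measure_mono)
    from borel_measurable_uminus[OF borel_measurable_mono[OF this]] show ?thesis by simp
  qed
  then show ?thesis by (simp add: DF.emeasure_eq_measure)
qed

text \<open>
  For fixed \<open>\<omega>\<close>, the points \<open>x \<in> [0,1]\<close> with \<open>S n \<omega> \<le> t - x\<close> and \<open>x < X n \<omega>\<close> form an interval of length
  \<open>min (X n \<omega>) (max 0 (t - S n \<omega>))\<close>, the length of \<open>[0,t]\<close> covered by the \<open>n\<close>-th step. Averaging over \<open>\<omega>\<close>
  first instead, independence splits the probability of these two conditions.
\<close>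

lemma expected_truncated_step:
  "(\<integral>\<^sup>+x\<in>{0..1}. emeasure M {\<omega>\<in>space M. S n \<omega> \<le> t - x} * emeasure F {x<..} \<partial>lborel)
     = (\<integral>\<^sup>+\<omega>. ennreal (min (X n \<omega>) (max 0 (t - S n \<omega>))) \<partial>M)"
proof -
  interpret pair_sigma_finite lborel M ..
  let ?I = "\<lambda>x \<omega>. if 0 \<le> x \<and> x \<le> 1 \<and> S n \<omega> \<le> t - x \<and> x < X n \<omega> then 1 else 0 :: ennreal"
  have prod: "emeasure M {\<omega>\<in>space M. S n \<omega> \<le> t - x} * emeasure F {x<..}
      = emeasure M {\<omega>\<in>space M. S n \<omega> \<le> t - x \<and> x < X n \<omega>}" for x
  proof -
    have "prob {\<omega>\<in>space M. S n \<omega> \<le> t - x \<and> x < X n \<omega>}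
        = prob {\<omega>\<in>space M. S n \<omega> \<le> t - x} * prob {\<omega>\<in>space M. x < X n \<omega>}"
      using indep_varD[OF indep_X_S[of n], of "{x<..}" "{..t - x}"]
      by (simp add: vimage_def Int_def conj_commute mult.commute)
    then show ?thesis
      unfolding emeasure_X_greater[of _ n, symmetric]
      by (simp add: emeasure_eq_measure ennreal_mult)
  qed
  have "(\<integral>\<^sup>+x\<in>{0..1}. emeasure M {\<omega>\<in>space M. S n \<omega> \<le> t - x} * emeasure F {x<..} \<partial>lborel)
      = (\<integral>\<^sup>+x. \<integral>\<^sup>+\<omega>. ?I x \<omega> \<partial>M \<partial>lborel)"
  proof (rule nn_integral_cong)
    fix x :: real
    have "(\<integral>\<^sup>+\<omega>. ?I x \<omega> \<partial>M)
        = (\<integral>\<^sup>+\<omega>. indicator {0..1} x * indicator {\<omega>\<in>space M. S n \<omega> \<le> t - x \<and> x < X n \<omega>} \<omega> \<partial>M)"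
      by (rule nn_integral_cong) (auto split: split_indicator)
    also have "\<dots> = indicator {0..1} x * emeasure M {\<omega>\<in>space M. S n \<omega> \<le> t - x \<and> x < X n \<omega>}"
      by (rule nn_integral_cmult_indicator) measurable
    finally show "emeasure M {\<omega>\<in>space M. S n \<omega> \<le> t - x} * emeasure F {x<..} * indicator {0..1} x = (\<integral>\<^sup>+\<omega>. ?I x \<omega> \<partial>M)"
      unfolding prod by (simp only: mult.commute)
  qed
  also have "\<dots> = (\<integral>\<^sup>+\<omega>. \<integral>\<^sup>+x. ?I x \<omega> \<partial>lborel \<partial>M)"
    by (rule Fubini'[symmetric]) measurable
  also have "\<dots> = (\<integral>\<^sup>+\<omega>. ennreal (min (X n \<omega>) (max 0 (t - S n \<omega>))) \<partial>M)"
  proof (rule nn_integral_cong_AE)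
    show "AE \<omega> in M. (\<integral>\<^sup>+x. ?I x \<omega> \<partial>lborel) = ennreal (min (X n \<omega>) (max 0 (t - S n \<omega>)))"
      using AE_step_range[of n]
    proof eventually_elim
      fix \<omega> assume X: "0 \<le> X n \<omega> \<and> X n \<omega> \<le> 1"
      let ?B = "{x. 0 \<le> x \<and> x \<le> t - S n \<omega> \<and> x < X n \<omega>}"
      have "(\<integral>\<^sup>+x. ?I x \<omega> \<partial>lborel) = (\<integral>\<^sup>+x. indicator ?B x \<partial>lborel)"
        using X by (intro nn_integral_cong) (auto split: split_indicator)
      also have "\<dots> = emeasure lborel ?B" by simp
      also have "\<dots> = ennreal (min (X n \<omega>) (max 0 (t - S n \<omega>)))"
      proof (cases "t - S n \<omega> < X n \<omega>")
        case True
        then have "?B = {0..t - S n \<omega>}" by auto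
        with True X show ?thesis by (auto simp: min_def max_def)
      next
        case False
        then have "?B = {0..<X n \<omega>}" by auto
        with False X show ?thesis by (auto simp: min_def max_def)
      qed
      finally show "(\<integral>\<^sup>+x. ?I x \<omega> \<partial>lborel) = ennreal (min (X n \<omega>) (max 0 (t - S n \<omega>)))" .
    qed
  qed
  finally show ?thesis .
qed

text \<open>
  The first \<open>m\<close> steps cover \<open>[0, min t (S m \<omega>)]\<close>, and \<open>max 0 (t - S m \<omega>)\<close> is the length left uncovered.
\<close>

lemma telescoping_shortfall:
  assumes "0 \<le> t"
  shows "(\<Sum>n<m. \<integral>\<^sup>+\<omega>. ennreal (min (X n \<omega>) (max 0 (t - S n \<omega>))) \<partial>M)
     + (\<integral>\<^sup>+\<omega>. ennreal (max 0 (t - S m \<omega>)) \<partial>M) = ennreal t"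
proof (induction m)
  case 0
  then show ?case using assms by (simp add: S_def emeasure_space_1)
next
  case (Suc m)
  have "(\<integral>\<^sup>+\<omega>. ennreal (min (X m \<omega>) (max 0 (t - S m \<omega>))) \<partial>M) + (\<integral>\<^sup>+\<omega>. ennreal (max 0 (t - S (Suc m) \<omega>)) \<partial>M)
      = (\<integral>\<^sup>+\<omega>. ennreal (min (X m \<omega>) (max 0 (t - S m \<omega>))) + ennreal (max 0 (t - S (Suc m) \<omega>)) \<partial>M)"
    by (rule nn_integral_add[symmetric]) measurable
  also have "\<dots> = (\<integral>\<^sup>+\<omega>. ennreal (max 0 (t - S m \<omega>)) \<partial>M)"
  proof (rule nn_integral_cong_AE)
    show "AE \<omega> in M. ennreal (min (X m \<omega>) (max 0 (t - S m \<omega>))) + ennreal (max 0 (t - S (Suc m) \<omega>))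
        = ennreal (max 0 (t - S m \<omega>))"
      using AE_step_range[of m]
    proof eventually_elim
      fix \<omega> assume X: "0 \<le> X m \<omega> \<and> X m \<omega> \<le> 1"
      have "min (X m \<omega>) (max 0 (t - S m \<omega>)) + max 0 (t - S (Suc m) \<omega>) = max 0 (t - S m \<omega>)"
        using X by (simp add: S_def min_def max_def)
      moreover have "0 \<le> min (X m \<omega>) (max 0 (t - S m \<omega>))" using X by simp
      ultimately show "ennreal (min (X m \<omega>) (max 0 (t - S m \<omega>))) + ennreal (max 0 (t - S (Suc m) \<omega>))
          = ennreal (max 0 (t - S m \<omega>))"
        by (metis ennreal_plus max.cobounded1)
    qed
  qed
  finally show ?case using Suc.IH by (simp add: add.assoc)
qed

lemma sum_U_tail:
  "(\<integral>\<^sup>+x\<in>{0..1}. U (t - x) * emeasure F {x<..} \<partial>lborel)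
     = (\<Sum>n. \<integral>\<^sup>+\<omega>. ennreal (min (X n \<omega>) (max 0 (t - S n \<omega>))) \<partial>M)"
proof -
  have "(\<integral>\<^sup>+x\<in>{0..1}. U (t - x) * emeasure F {x<..} \<partial>lborel)
     = (\<integral>\<^sup>+x. (\<Sum>n. emeasure M {\<omega>\<in>space M. S n \<omega> \<le> t - x} * emeasure F {x<..} * indicator {0..1} x) \<partial>lborel)"
    unfolding U_def by (simp add: ennreal_suminf_multc)
  also have "\<dots> = (\<Sum>n. \<integral>\<^sup>+x\<in>{0..1}. emeasure M {\<omega>\<in>space M. S n \<omega> \<le> t - x} * emeasure F {x<..} \<partial>lborel)"
    by (rule nn_integral_suminf) measurable
  finally show ?thesis unfolding expected_truncated_step .
qed

text \<open>
  Equality needs the uncovered length to vanish in the limit, which is deduced from the finiteness of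
  \<open>U\<close>. The inequality holds without that knowledge and is what yields the finiteness.
\<close>

lemma integral_U_tail_le:
  assumes "0 \<le> t"
  shows "(\<integral>\<^sup>+x\<in>{0..1}. U (t - x) * emeasure F {x<..} \<partial>lborel) \<le> ennreal t"
  unfolding sum_U_tail
proof (rule suminf_le_const[OF summableI])
  fix m
  show "(\<Sum>n<m. \<integral>\<^sup>+\<omega>. ennreal (min (X n \<omega>) (max 0 (t - S n \<omega>))) \<partial>M) \<le> ennreal t"
    unfolding telescoping_shortfall[OF assms, of m, symmetric] by (rule add_increasing2) simp_all
qed

text \<open>
  For \<open>x \<le> 1\<close> monotonicity gives \<open>U t \<le> U (t + 1 - x)\<close>, so the tail integral at time \<open>t + 1\<close> dominates
  \<open>U t\<close> times the mean.
\<close>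

lemma U_mean_le:
  assumes "0 \<le> t"
  shows "U t * (\<integral>\<^sup>+x\<in>{0..1}. emeasure F {x<..} \<partial>lborel) \<le> ennreal (t + 1)"
proof -
  have "U t * (\<integral>\<^sup>+x\<in>{0..1}. emeasure F {x<..} \<partial>lborel) = (\<integral>\<^sup>+x\<in>{0..1}. U t * emeasure F {x<..} \<partial>lborel)"
    by (subst nn_integral_cmult[symmetric]) (auto simp: mult.assoc)
  also have "\<dots> \<le> (\<integral>\<^sup>+x\<in>{0..1}. U (t + 1 - x) * emeasure F {x<..} \<partial>lborel)"
    by (intro nn_integral_mono) (simp split: split_indicator add: mult_right_mono monoD[OF mono_U])
  also have "\<dots> \<le> ennreal (t + 1)"
    using assms by (intro integral_U_tail_le) auto
  finally show ?thesis .
qed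

lemma U_finite: "U t < \<top>"
proof -
  have "U (max 0 t) \<noteq> \<top>"
  proof
    assume "U (max 0 t) = \<top>"
    then have "\<top> \<le> ennreal (max 0 t + 1)"
      using U_mean_le[of "max 0 t"] mean_pos by (simp add: ennreal_top_mult)
    then show False by (simp add: top_unique)
  qed
  moreover have "U t \<le> U (max 0 t)" by (intro monoD[OF mono_U]) auto
  ultimately show ?thesis by (auto simp: top_unique less_top)
qed

lemma prob_S_tendsto_0: "(\<lambda>n. prob {\<omega>\<in>space M. S n \<omega> \<le> t}) \<longlonglongrightarrow> 0"
proof (rule summable_LIMSEQ_zero, rule summable_suminf_not_top)
  show "(\<Sum>n. ennreal (prob {\<omega>\<in>space M. S n \<omega> \<le> t})) \<noteq> \<top>"
    using U_finite[of t] unfolding U_def emeasure_eq_measure by simp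
qed simp

text \<open>
  The uncovered length after \<open>n\<close> steps is at most \<open>t\<close> and vanishes unless \<open>S n \<omega> \<le> t\<close>. Its expectation
  is therefore at most \<open>t\<close> times a probability that tends to \<open>0\<close>, being a term of the convergent series \<open>U t\<close>.
\<close>

lemma integral_U_tail:
  assumes "0 \<le> t"
  shows "(\<integral>\<^sup>+x\<in>{0..1}. U (t - x) * emeasure F {x<..} \<partial>lborel) = ennreal t"
proof -
  let ?a = "\<lambda>n. \<integral>\<^sup>+\<omega>. ennreal (min (X n \<omega>) (max 0 (t - S n \<omega>))) \<partial>M"
  let ?r = "\<lambda>n. \<integral>\<^sup>+\<omega>. ennreal (max 0 (t - S n \<omega>)) \<partial>M"
  have r_le: "?r n \<le> ennreal (t * prob {\<omega>\<in>space M. S n \<omega> \<le> t})" for n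
  proof -
    have "?r n \<le> (\<integral>\<^sup>+\<omega>. ennreal t * indicator {\<omega>\<in>space M. S n \<omega> \<le> t} \<omega> \<partial>M)"
    proof (rule nn_integral_mono_AE)
      show "AE \<omega> in M. ennreal (max 0 (t - S n \<omega>)) \<le> ennreal t * indicator {\<omega>\<in>space M. S n \<omega> \<le> t} \<omega>"
        using AE_S_nonneg[of n] AE_space
        by eventually_elim (auto split: split_indicator intro!: ennreal_leI ennreal_neg)
    qed
    also have "\<dots> = ennreal t * emeasure M {\<omega>\<in>space M. S n \<omega> \<le> t}"
      by (rule nn_integral_cmult_indicator) measurable
    also have "\<dots> = ennreal (t * prob {\<omega>\<in>space M. S n \<omega> \<le> t})"
      using assms by (simp add: emeasure_eq_measure ennreal_mult)
    finally show ?thesis .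
  qed
  have "?r \<longlonglongrightarrow> 0"
  proof (rule tendsto_sandwich[OF _ _ tendsto_const])
    have "(\<lambda>n. t * prob {\<omega>\<in>space M. S n \<omega> \<le> t}) \<longlonglongrightarrow> 0"
      using tendsto_mult_right_zero[OF prob_S_tendsto_0] .
    then show "(\<lambda>n. ennreal (t * prob {\<omega>\<in>space M. S n \<omega> \<le> t})) \<longlonglongrightarrow> 0"
      using tendsto_ennrealI by fastforce
  qed (use r_le in auto)
  then have "(\<lambda>m. (\<Sum>n<m. ?a n) + ?r m) \<longlonglongrightarrow> (\<Sum>n. ?a n) + 0"
    by (intro tendsto_add summable_LIMSEQ summableI)
  then have "(\<lambda>m. ennreal t) \<longlonglongrightarrow> (\<Sum>n. ?a n)"
    unfolding telescoping_shortfall[OF assms] by simp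
  then show ?thesis
    unfolding sum_U_tail using LIMSEQ_unique tendsto_const by blast
qed

lemma mean_le_U:
  assumes "0 \<le> t"
  shows "ennreal t \<le> U t * (\<integral>\<^sup>+x\<in>{0..1}. emeasure F {x<..} \<partial>lborel)"
proof -
  have "ennreal t = (\<integral>\<^sup>+x\<in>{0..1}. U (t - x) * emeasure F {x<..} \<partial>lborel)"
    using integral_U_tail[OF assms] by simp
  also have "\<dots> \<le> (\<integral>\<^sup>+x\<in>{0..1}. U t * emeasure F {x<..} \<partial>lborel)"
    by (intro nn_integral_mono) (simp split: split_indicator add: mult_right_mono monoD[OF mono_U])
  also have "\<dots> = U t * (\<integral>\<^sup>+x\<in>{0..1}. emeasure F {x<..} \<partial>lborel)"
    by (subst nn_integral_cmult[symmetric]) (auto simp: mult.assoc)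
  finally show ?thesis .
qed

lemma AE_S_exceeds: "AE \<omega> in M. \<exists>n. t < S n \<omega>"
proof -
  have "prob {\<omega>\<in>space M. \<forall>n. S n \<omega> \<le> t} \<le> 0"
  proof (rule LIMSEQ_le_const[OF prob_S_tendsto_0[of t]], intro exI allI impI)
    fix n
    show "prob {\<omega>\<in>space M. \<forall>n. S n \<omega> \<le> t} \<le> prob {\<omega>\<in>space M. S n \<omega> \<le> t}"
      by (rule finite_measure_mono) auto
  qed
  then have "AE \<omega> in M. \<not> (\<forall>n. S n \<omega> \<le> t)"
    by (subst AE_iff_measurable[OF _ refl]) (simp_all add: emeasure_eq_measure measure_le_0_iff)
  then show ?thesis by (simp add: not_le)
qed

end
section \<open>Bounded functions that contract over unit time steps\<close>

text \<open>
  The contraction turns a bound valid from time \<open>a\<close> on into a smaller one valid from time \<open>a + 1\<close> on;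
  iterating it gives \<open>\<bar>D t\<bar> \<le> \<rho> ^ n * B\<close> for \<open>t \<ge> n\<close>.
\<close>

lemma tendsto_0_if_contracting:
  fixes D :: "real \<Rightarrow> real"
  assumes bound: "\<And>t. 0 \<le> t \<Longrightarrow> \<bar>D t\<bar> \<le> B"
    and contract: "\<And>a b t. 0 \<le> a \<Longrightarrow> (\<And>s. a \<le> s \<Longrightarrow> \<bar>D s\<bar> \<le> b) \<Longrightarrow> a + 1 \<le> t \<Longrightarrow> \<bar>D t\<bar> \<le> \<rho> * b"
    and \<rho>: "0 \<le> \<rho>" "\<rho> < 1"
  shows "(D \<longlongrightarrow> 0) at_top"
proof (rule tendstoI)
  have decay: "real n \<le> t \<Longrightarrow> \<bar>D t\<bar> \<le> \<rho> ^ n * B" for n t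
  proof (induction n arbitrary: t)
    case 0
    then show ?case using bound by simp
  next
    case (Suc n)
    have "\<bar>D t\<bar> \<le> \<rho> * (\<rho> ^ n * B)"
      using Suc.IH Suc.prems by (intro contract[of "real n"]) auto
    then show ?case by (simp add: mult.assoc)
  qed
  fix \<epsilon> :: real assume "0 < \<epsilon>"
  have "(\<lambda>n. \<rho> ^ n * B) \<longlonglongrightarrow> 0"
    using \<rho> by (intro tendsto_mult_left_zero LIMSEQ_realpow_zero)
  from order_tendstoD(2)[OF this \<open>0 < \<epsilon>\<close>] obtain n where "\<rho> ^ n * B < \<epsilon>"
    by (auto simp: eventually_sequentially)
  then show "\<forall>\<^sub>F t in at_top. dist (D t) 0 < \<epsilon>"
    using decay[of n] by (intro eventually_at_top_linorderI[of "real n"]) fastforce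
qed

lemma exp_1_ge_2: "(2::real) \<le> exp 1"
  using exp_ge_add_one_self[of 1] by simp

section \<open>The logarithm of a uniform variable on [1,e]\<close>

definition log_uniform :: "real measure" where
  "log_uniform = distr (uniform_measure lborel {1..exp 1}) borel ln"

lemma AE_log_uniform: "AE x in log_uniform. 0 \<le> x \<and> x \<le> 1"
proof -
  have "AE z in uniform_measure lborel {1..exp 1}. 0 \<le> ln z \<and> ln z \<le> (1::real)"
  proof (rule AE_uniform_measureI)
    have "0 \<le> ln z \<and> ln z \<le> 1" if "z \<in> {1..exp 1}" for z :: real
      using that ln_le_cancel_iff[of z "exp 1"] by simp
    then show "AE z in lborel. z \<in> {1..exp 1} \<longrightarrow> 0 \<le> ln z \<and> ln z \<le> (1::real)"
      by simp
  qed simp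
  then show ?thesis
    unfolding log_uniform_def by (subst AE_distr_iff) auto
qed

lemma nn_integral_log_uniform:
  fixes g :: "real \<Rightarrow> real"
  assumes [measurable]: "g \<in> borel_measurable borel" and nonneg: "\<And>x. 0 \<le> g x"
  shows "(\<integral>\<^sup>+x. g x \<partial>log_uniform) = (\<integral>\<^sup>+x\<in>{0..1}. ennreal (g x * (exp x / (exp 1 - 1))) \<partial>lborel)"
proof -
  have e: "0 < exp 1 - (1::real)" using exp_1_ge_2 by simp
  have "(\<integral>\<^sup>+x. g x \<partial>log_uniform) = (\<integral>\<^sup>+z. g (ln z) \<partial>uniform_measure lborel {1..exp 1})"
    unfolding log_uniform_def by (rule nn_integral_distr) measurable
  also have "\<dots> = (\<integral>\<^sup>+z. ennreal (g (ln z)) * indicator {1..exp 1} z \<partial>lborel) / ennreal (exp 1 - 1)"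
    using e by (subst nn_integral_uniform_measure) auto
  also have "(\<integral>\<^sup>+z. ennreal (g (ln z)) * indicator {1..exp 1} z \<partial>lborel)
      = (\<integral>\<^sup>+z. ennreal (g (ln z) * indicator {exp 0..exp 1} z) \<partial>lborel)"
    by (rule nn_integral_cong) (simp split: split_indicator)
  also have "\<dots> = (\<integral>\<^sup>+x. ennreal (g (ln (exp x)) * exp x * indicator {0..1} x) \<partial>lborel)"
  proof (rule nn_integral_substitution)
    show "set_borel_measurable borel {exp 0..exp 1} (\<lambda>z. g (ln z))"
      unfolding set_borel_measurable_def by measurable
  qed (auto intro!: continuous_intros derivative_eq_intros)
  also have "\<dots> / ennreal (exp 1 - 1)
      = (\<integral>\<^sup>+x\<in>{0..1}. ennreal (g x * (exp x / (exp 1 - 1))) \<partial>lborel)"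
    using e nonneg
    by (subst nn_integral_divide[symmetric])
      (auto intro!: nn_integral_cong simp: divide_ennreal split: split_indicator)
  finally show ?thesis .
qed

lemma tail_log_uniform:
  assumes "0 \<le> x" "x \<le> 1"
  shows "emeasure log_uniform {x<..} = ennreal ((exp 1 - exp x) / (exp 1 - 1))"
proof -
  have e: "0 < exp 1 - (1::real)" using exp_1_ge_2 by simp
  have "emeasure log_uniform {x<..} = emeasure (uniform_measure lborel {1..exp 1}) (ln -` {x<..})"
    unfolding log_uniform_def by (subst emeasure_distr) auto
  also have "\<dots> = emeasure lborel ({1..exp 1} \<inter> ln -` {x<..}) / emeasure lborel {1..exp (1::real)}"
  proof (rule emeasure_uniform_measure)
    have "(ln :: real \<Rightarrow> real) \<in> borel_measurable borel" by measurable
    from measurable_sets[OF this, of "{x<..}"] show "ln -` {x<..} \<in> sets (lborel :: real measure)"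
      by simp
  qed simp
  also have "{1..exp 1} \<inter> ln -` {x<..} = {exp x<..exp 1}"
  proof safe
    fix z :: real assume z: "z \<in> {1..exp 1}" "x < ln z"
    then show "z \<in> {exp x<..exp 1}"
      using exp_less_mono[of x "ln z"] by simp
  next
    fix z :: real assume z: "z \<in> {exp x<..exp 1}"
    moreover have "1 \<le> exp x" using assms by simp
    ultimately have z1: "1 < z" by (metis greaterThanAtMost_iff le_less_trans)
    then show "z \<in> {1..exp 1}" using z by auto
    show "z \<in> ln -` {x<..}"
      using z z1 ln_less_cancel_iff[of "exp x" z] by simp
  qed
  also have "emeasure lborel {exp x<..exp 1} / emeasure lborel {1..exp (1::real)}
      = ennreal ((exp 1 - exp x) / (exp 1 - 1))"
    using assms e by (simp add: divide_ennreal)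
  finally show ?thesis .
qed

lemma mean_log_uniform:
  "(\<integral>\<^sup>+x\<in>{0..1}. emeasure log_uniform {x<..} \<partial>lborel) = ennreal (1 / (exp 1 - 1))"
proof -
  have e: "0 < exp 1 - (1::real)" using exp_1_ge_2 by simp
  have "(\<integral>\<^sup>+x\<in>{0..1}. emeasure log_uniform {x<..} \<partial>lborel)
      = (\<integral>\<^sup>+x\<in>{0..1}. ennreal ((exp 1 - exp x) / (exp 1 - 1)) \<partial>lborel)"
    by (intro nn_integral_cong) (auto simp: tail_log_uniform split: split_indicator)
  also have "\<dots> = ennreal ((exp 1 * 1 - exp 1) / (exp 1 - 1) - (exp 1 * 0 - exp 0) / (exp 1 - 1))"
    using e by (intro nn_integral_FTC_Icc) (auto intro!: derivative_eq_intros)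
  finally show ?thesis by simp
qed

section \<open>The residual kernel\<close>

text \<open>
  What remains of the density \<open>e\<^sup>x / (e - 1)\<close> after subtracting \<open>1 / (e - 1)\<close> times the tail
  \<open>(e - e\<^sup>x) / (e - 1)\<close>. The factor \<open>1 / (e - 1)\<close> is the largest one that leaves a nonnegative function on
  \<open>[0,1]\<close>; the remainder vanishes at \<open>0\<close>.
\<close>

definition residual_density :: "real \<Rightarrow> real" where
  "residual_density x = exp 1 * (exp x - 1) / (exp 1 - 1)^2"

lemma measurable_residual_density [measurable]: "residual_density \<in> borel_measurable borel"
  unfolding residual_density_def by measurable

lemma residual_density_nonneg: "0 \<le> x \<Longrightarrow> 0 \<le> residual_density x"
  by (simp add: residual_density_def)

lemma density_decomposition:
  "exp x / (exp 1 - 1) = (exp 1 - exp x) / (exp 1 - 1) / (exp 1 - 1) + residual_density x"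
proof -
  have e: "exp 1 - (1::real) \<noteq> 0" using exp_1_ge_2 by simp
  have "exp x / (exp 1 - 1) = exp x * (exp 1 - 1) / (exp 1 - 1)^2"
    using e by (simp add: power2_eq_square)
  also have "\<dots> = (exp 1 - exp x) / (exp 1 - 1)^2 + exp 1 * (exp x - 1) / (exp 1 - 1)^2"
    unfolding add_divide_distrib[symmetric] by (simp add: algebra_simps)
  finally show ?thesis by (simp add: residual_density_def power2_eq_square)
qed

lemma affine_residual_integral:
  fixes A C :: real
  shows "has_bochner_integral lborel (\<lambda>x. (A + C * x) * residual_density x * indicator {0..1} x)
     (exp 1 / (exp 1 - 1)^2 * (A * (exp 1 - 2) + C / 2))"
proof -
  let ?k = "exp 1 / (exp 1 - 1)^2 :: real"
  \<comment> \<open>Antiderivatives of \<open>e\<^sup>x - 1\<close> and of \<open>x (e\<^sup>x - 1)\<close> are \<open>e\<^sup>x - x\<close> and \<open>(x - 1) e\<^sup>x - x\<^sup>2 / 2\<close>.\<close>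
  let ?G = "\<lambda>x. ?k * (A * (exp x - x) + C * ((x - 1) * exp x - x^2 / 2))"
  have "has_bochner_integral lborel (\<lambda>x. (?k * (A * (exp x - 1) + C * (x * exp x - x))) * indicator {0..1} x) (?G 1 - ?G 0)"
  proof (rule has_bochner_integral_FTC_Icc_real)
    fix x :: real
    show "DERIV ?G x :> ?k * (A * (exp x - 1) + C * (x * exp x - x))"
      by (rule derivative_eq_intros refl | simp add: algebra_simps)+
  qed auto
  also have "?G 1 - ?G 0 = ?k * (A * (exp 1 - 2) + C / 2)"
    unfolding right_diff_distrib[symmetric] by (simp add: algebra_simps)
  also have "(\<lambda>x. (?k * (A * (exp x - 1) + C * (x * exp x - x))) * indicator {0..1} x)
      = (\<lambda>x. (A + C * x) * residual_density x * indicator {0..1} x)"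
    by (auto simp: fun_eq_iff residual_density_def algebra_simps add_divide_distrib diff_divide_distrib
        split: split_indicator)
  finally show ?thesis .
qed

text \<open>
  The step density has mass \<open>1\<close> and the tail has mass \<open>1 / (e - 1)\<close>, so subtracting \<open>1 / (e - 1)\<close> times the
  tail leaves mass \<open>1 - 1 / (e - 1)\<^sup>2\<close>. This is the contraction factor.
\<close>

lemma residual_mass:
  "has_bochner_integral lborel (\<lambda>x. residual_density x * indicator {0..1} x) (1 - 1 / (exp 1 - 1)^2)"
proof -
  define c :: real where "c = exp 1 - 1"
  have c: "c \<noteq> 0" and e: "exp 1 = c + 1" using exp_1_ge_2 by (auto simp: c_def)
  have "exp 1 / (exp 1 - 1)^2 * (1 * (exp 1 - 2) + 0 / 2) = (1 - 1 / (exp 1 - 1)^2 :: real)"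
    unfolding e using c by (simp add: field_simps power2_eq_square)
  with affine_residual_integral[of 1 0] show ?thesis by simp
qed

definition asymptote :: "real \<Rightarrow> real" where
  "asymptote t = (exp 1 - 1) * (t + (exp 1 - 2) / 2)"

text \<open>
  The slope \<open>e - 1\<close> and the constant \<open>(e - 1) (e - 2) / 2\<close> are the only coefficients for which an affine
  function solves the equation of \<open>N_equation\<close>.
\<close>

lemma asymptote_equation:
  "has_bochner_integral lborel (\<lambda>x. asymptote (t - x) * residual_density x * indicator {0..1} x)
     (asymptote t - (1 + t / (exp 1 - 1)))"
proof -
  define c :: real where "c = exp 1 - 1"
  have c: "c \<noteq> 0" and e: "exp 1 = c + 1" using exp_1_ge_2 by (auto simp: c_def)
  have "exp 1 / (exp 1 - 1)^2 * (asymptote t * (exp 1 - 2) + - (exp 1 - 1) / 2)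
      = asymptote t - (1 + t / (exp 1 - 1))"
    unfolding asymptote_def e using c by (simp add: field_simps power2_eq_square)
  moreover have "asymptote (t - x) = asymptote t + - (exp 1 - 1) * x" for x
    by (simp add: asymptote_def algebra_simps)
  ultimately show ?thesis
    using affine_residual_integral[of "asymptote t" "- (exp 1 - 1)"] by simp
qed

section \<open>Selections as a renewal process\<close>

locale uniform_selections = prob_space M
  for M :: "'a measure" +
  fixes Z :: "nat \<Rightarrow> 'a \<Rightarrow> real"
  assumes iid: "iid_uniform M Z 1 (exp 1)"
begin

lemma indep_Z: "indep_vars (\<lambda>_. borel) Z UNIV"
  using iid by (simp add: iid_uniform_def)

lemma distr_Z: "distr M borel (Z k) = uniform_measure lborel {1..exp 1}"
  using iid by (simp add: iid_uniform_def)

lemma measurable_Z [measurable]: "Z k \<in> borel_measurable M"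
  using indep_Z by (auto simp: indep_vars_def)

sublocale bounded_renewal M "\<lambda>k \<omega>. ln (Z k \<omega>)" log_uniform
proof
  show "indep_vars (\<lambda>_. borel) (\<lambda>k \<omega>. ln (Z k \<omega>)) UNIV"
    by (rule indep_vars_compose2[OF indep_Z]) measurable
  show "distr M borel (\<lambda>\<omega>. ln (Z n \<omega>)) = log_uniform" for n
    unfolding log_uniform_def distr_Z[of n, symmetric] by (subst distr_distr) (auto simp: comp_def)
  show "AE x in log_uniform. 0 \<le> x \<and> x \<le> 1"
    by (rule AE_log_uniform)
  show "(\<integral>\<^sup>+x\<in>{0..1}. emeasure log_uniform {x<..} \<partial>lborel) \<noteq> 0"
    unfolding mean_log_uniform using exp_1_ge_2 by simp
qed

lemma AE_Z_range: "AE \<omega> in M. \<forall>k. 1 \<le> Z k \<omega>"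
proof -
  have "AE z in uniform_measure lborel {1..exp 1::real}. 1 \<le> z"
    by (rule AE_uniform_measureI) auto
  then have "AE \<omega> in M. 1 \<le> Z k \<omega>" for k
    unfolding distr_Z[of k, symmetric] by (subst (asm) AE_distr_iff) auto
  then show ?thesis by (simp add: AE_all_countable)
qed

text \<open>
  The walk never decreases, so the times at which it is at most \<open>t\<close> are exactly those before the first
  passage. Time \<open>0\<close> is one of them since \<open>t \<ge> 0\<close>, so the passage takes at least one selection.
\<close>

lemma num_selections_eq_count:
  assumes Z: "\<And>k. 1 \<le> Z k \<omega>" and ex: "\<exists>n. t < S n \<omega>" and t: "0 \<le> t"
  shows "ennreal (real (num_selections Z t \<omega>)) = (\<Sum>n. indicator {\<omega>. S n \<omega> \<le> t} \<omega>)"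
proof -
  have prod: "(\<Prod>k<n. Z k \<omega>) = exp (S n \<omega>)" for n
  proof -
    have "0 < Z k \<omega>" for k using Z[of k] by simp
    then show ?thesis by (simp add: S_def exp_sum)
  qed
  have S0: "S 0 \<omega> = 0" by (simp add: S_def)
  have mono: "S m \<omega> \<le> S n \<omega>" if "m \<le> n" for m n
    unfolding S_def using that Z by (intro sum_mono2) auto
  define m where "m = num_selections Z t \<omega>"
  have m: "m = (LEAST n. n \<ge> 1 \<and> t < S n \<omega>)"
    by (simp add: m_def num_selections_def prod)
  from ex obtain n where n: "t < S n \<omega>" by blast
  with S0 t have "n \<ge> 1" by (cases n) auto
  with n have "m \<ge> 1 \<and> t < S m \<omega>"
    unfolding m by (intro LeastI[of "\<lambda>n. n \<ge> 1 \<and> t < S n \<omega>" n]) simp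
  then have above: "t < S n \<omega>" if "m \<le> n" for n
    using mono[OF that] by simp
  have below: "S n \<omega> \<le> t" if "n < m" for n
    using not_less_Least[of n "\<lambda>n. n \<ge> 1 \<and> t < S n \<omega>"] that S0 t unfolding m by (cases n) auto
  have "(\<Sum>n. indicator {\<omega>. S n \<omega> \<le> t} \<omega> :: ennreal) = (\<Sum>n\<in>{..<m}. indicator {\<omega>. S n \<omega> \<le> t} \<omega>)"
    using above by (intro suminf_finite) (auto split: split_indicator simp: not_less not_le)
  also have "\<dots> = (\<Sum>n\<in>{..<m}. 1)"
    using below by (intro sum.cong) auto
  finally show ?thesis by (simp add: m_def ennreal_of_nat_eq_real_of_nat)
qed

lemma expected_selections_eq_U:
  assumes "0 \<le> t"
  shows "expected_selections M Z t = enn2real (U t)"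
proof -
  have [measurable]: "num_selections Z t \<in> measurable M (count_space UNIV)"
    unfolding num_selections_def[abs_def] by measurable
  have "(\<integral>\<^sup>+\<omega>. ennreal (real (num_selections Z t \<omega>)) \<partial>M)
      = (\<integral>\<^sup>+\<omega>. (\<Sum>n. indicator {\<omega>\<in>space M. S n \<omega> \<le> t} \<omega>) \<partial>M)"
  proof (rule nn_integral_cong_AE)
    show "AE \<omega> in M. ennreal (real (num_selections Z t \<omega>)) = (\<Sum>n. indicator {\<omega>\<in>space M. S n \<omega> \<le> t} \<omega>)"
      using AE_Z_range AE_S_exceeds[of t] AE_space
    proof eventually_elim
      fix \<omega> assume "\<forall>k. 1 \<le> Z k \<omega>" "\<exists>n. t < S n \<omega>" "\<omega> \<in> space M"
      then show "ennreal (real (num_selections Z t \<omega>)) = (\<Sum>n. indicator {\<omega>\<in>space M. S n \<omega> \<le> t} \<omega>)"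
        using assms by (subst num_selections_eq_count) (auto simp: indicator_def)
    qed
  qed
  also have "\<dots> = (\<Sum>n. \<integral>\<^sup>+\<omega>. indicator {\<omega>\<in>space M. S n \<omega> \<le> t} \<omega> \<partial>M)"
    by (rule nn_integral_suminf) measurable
  also have "\<dots> = U t"
    by (simp add: U_def)
  finally show ?thesis
    unfolding expected_selections_def by (subst integral_eq_nn_integral) auto
qed

section \<open>Convergence to the asymptote\<close>

definition N :: "real \<Rightarrow> real" where
  "N t = enn2real (U t)"

lemma U_eq_N: "U t = ennreal (N t)"
  using U_finite[of t] by (simp add: N_def)

lemma N_nonneg: "0 \<le> N t"
  by (simp add: N_def)

lemma measurable_N [measurable]: "N \<in> borel_measurable borel"
  unfolding N_def[abs_def] by measurable

text \<open>
  The mean step is \<open>1 / (e - 1)\<close>, so these bounds place \<open>N\<close> at bounded distance from any line of slope \<open>e - 1\<close>.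
\<close>

lemma N_bounds:
  assumes "0 \<le> t"
  shows "(exp 1 - 1) * t \<le> N t" "N t \<le> (exp 1 - 1) * (t + 1)"
proof -
  have e: "0 < exp 1 - (1::real)" using exp_1_ge_2 by simp
  have "U t * ennreal (1 / (exp 1 - 1)) = ennreal (N t / (exp 1 - 1))"
    unfolding U_eq_N using e N_nonneg[of t] by (simp add: ennreal_mult[symmetric] del: ennreal_1)
  with mean_le_U[OF assms] U_mean_le[OF assms]
  have "ennreal t \<le> ennreal (N t / (exp 1 - 1))" "ennreal (N t / (exp 1 - 1)) \<le> ennreal (t + 1)"
    unfolding mean_log_uniform by simp_all
  then have "t \<le> N t / (exp 1 - 1)" "N t / (exp 1 - 1) \<le> t + 1"
    using assms e N_nonneg[of t] by (simp_all del: ennreal_plus)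
  then show "(exp 1 - 1) * t \<le> N t" "N t \<le> (exp 1 - 1) * (t + 1)"
    using e by (simp_all add: field_simps)
qed

text \<open>
  In the renewal equation, the part of the density proportional to the tail contributes exactly
  \<open>t / (e - 1)\<close> by \<open>integral_U_tail\<close>. Only the residual kernel, of mass less than \<open>1\<close>, still acts on \<open>N\<close>.
\<close>

lemma N_equation:
  assumes "0 \<le> t"
  shows "has_bochner_integral lborel (\<lambda>x. N (t - x) * residual_density x * indicator {0..1} x)
     (N t - (1 + t / (exp 1 - 1)))"
proof -
  have e: "0 < exp 1 - (1::real)" using exp_1_ge_2 by simp
  let ?J = "\<integral>\<^sup>+x. ennreal (N (t - x) * residual_density x * indicator {0..1} x) \<partial>lborel"
  have "ennreal (N t) = 1 + (\<integral>\<^sup>+x. ennreal (N (t - x)) \<partial>log_uniform)"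
    using renewal_equation[OF assms] unfolding U_eq_N .
  also have "(\<integral>\<^sup>+x. ennreal (N (t - x)) \<partial>log_uniform)
      = (\<integral>\<^sup>+x\<in>{0..1}. ennreal (N (t - x) * (exp x / (exp 1 - 1))) \<partial>lborel)"
    by (rule nn_integral_log_uniform) (auto simp: N_nonneg)
  also have "\<dots> = (\<integral>\<^sup>+x. ennreal (1 / (exp 1 - 1)) * (U (t - x) * emeasure log_uniform {x<..} * indicator {0..1} x)
       + ennreal (N (t - x) * residual_density x * indicator {0..1} x) \<partial>lborel)"
  proof (rule nn_integral_cong)
    fix x :: real
    show "ennreal (N (t - x) * (exp x / (exp 1 - 1))) * indicator {0..1} x
      = ennreal (1 / (exp 1 - 1)) * (U (t - x) * emeasure log_uniform {x<..} * indicator {0..1} x)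
       + ennreal (N (t - x) * residual_density x * indicator {0..1} x)"
    proof (cases "x \<in> {0..1}")
      case True
      then have x: "0 \<le> x" "x \<le> 1" by auto
      let ?G = "(exp 1 - exp x) / (exp 1 - 1) :: real"
      have G: "0 \<le> ?G" using x e by simp
      have "N (t - x) * (exp x / (exp 1 - 1)) = 1 / (exp 1 - 1) * (N (t - x) * ?G) + N (t - x) * residual_density x"
        unfolding density_decomposition by (simp add: distrib_left)
      also have "ennreal \<dots> = ennreal (1 / (exp 1 - 1)) * (ennreal (N (t - x)) * ennreal ?G) + ennreal (N (t - x) * residual_density x)"
        using e G N_nonneg[of "t - x"] residual_density_nonneg[OF x(1)]
        by (subst ennreal_plus) (simp_all only: ennreal_mult mult_nonneg_nonneg zero_le_divide_1_iff less_imp_le)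
      finally show ?thesis
        using True x by (simp add: U_eq_N tail_log_uniform)
    qed simp
  qed
  also have "\<dots> = ennreal (1 / (exp 1 - 1)) * ennreal t + ?J"
    by (subst nn_integral_add) (simp_all add: nn_integral_cmult integral_U_tail[OF assms])
  also have "ennreal (1 / (exp 1 - 1)) * ennreal t = ennreal (t / (exp 1 - 1))"
    using e assms by (simp add: ennreal_mult[symmetric])
  finally have eq: "ennreal (N t) = ennreal (1 + t / (exp 1 - 1)) + ?J"
    using e assms by (simp add: add.assoc)
  then obtain j where j: "?J = ennreal j" "0 \<le> j"
    by (cases ?J) auto
  have "ennreal (N t) = ennreal (1 + t / (exp 1 - 1) + j)"
    using eq j e assms by (simp add: ennreal_plus)
  then have "j = N t - (1 + t / (exp 1 - 1))"
    using N_nonneg[of t] e assms j(2) by (subst (asm) ennreal_inj) auto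
  with j show ?thesis
    by (intro has_bochner_integral_nn_integral)
      (auto simp: N_nonneg residual_density_nonneg split: split_indicator)
qed

lemma error_equation:
  assumes "0 \<le> t"
  shows "has_bochner_integral lborel
     (\<lambda>x. (N (t - x) - asymptote (t - x)) * residual_density x * indicator {0..1} x)
     (N t - asymptote t)"
  using has_bochner_integral_diff[OF N_equation[OF assms] asymptote_equation[of t]]
  by (simp add: algebra_simps)

text \<open>
  At time \<open>t \<ge> a + 1\<close> the error is the integral, against a nonnegative kernel of mass
  \<open>1 - 1 / (e - 1)\<^sup>2\<close>, of its values on \<open>[t - 1, t]\<close>, all of which lie beyond \<open>a\<close>.
\<close>

lemma error_contracts:
  assumes "0 \<le> a" and small: "\<And>s. a \<le> s \<Longrightarrow> \<bar>N s - asymptote s\<bar> \<le> b" and t: "a + 1 \<le> t"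
  shows "\<bar>N t - asymptote t\<bar> \<le> (1 - 1 / (exp 1 - 1)^2) * b"
proof -
  let ?D = "\<lambda>s. N s - asymptote s"
  have "0 \<le> t" using assms by simp
  note D = error_equation[OF this]
  have "norm (\<integral>x. ?D (t - x) * residual_density x * indicator {0..1} x \<partial>lborel)
      \<le> (\<integral>x. b * (residual_density x * indicator {0..1} x) \<partial>lborel)"
  proof (rule Bochner_Integration.integral_norm_bound_integral)
    show "integrable lborel (\<lambda>x. ?D (t - x) * residual_density x * indicator {0..1} x)"
      using D by (simp add: has_bochner_integral_iff)
    show "integrable lborel (\<lambda>x. b * (residual_density x * indicator {0..1} x))"
      using residual_mass by (simp add: has_bochner_integral_iff)
    fix x :: real
    show "norm (?D (t - x) * residual_density x * indicator {0..1} x) \<le> b * (residual_density x * indicator {0..1} x)"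
      using small[of "t - x"] t residual_density_nonneg[of x]
      by (auto simp: abs_mult intro!: mult_right_mono split: split_indicator)
  qed
  then show ?thesis
    using D residual_mass by (simp add: has_bochner_integral_iff mult.commute)
qed

lemma error_bounded:
  assumes "0 \<le> t"
  shows "\<bar>N t - asymptote t\<bar> \<le> (exp 1 - 1) * exp 1"
proof -
  \<comment> \<open>With \<open>c = e - 1\<close>, the error lies between \<open>- c * ((c - 1) / 2)\<close> and \<open>c\<close>.\<close>
  define c :: real where "c = exp 1 - 1"
  have c: "1 \<le> c" using exp_1_ge_2 by (simp add: c_def)
  have N: "c * t \<le> N t" "N t \<le> c * t + c"
    using N_bounds[OF assms] by (simp_all add: c_def algebra_simps)
  have "asymptote t = c * t + c * ((c - 1) / 2)"
    by (simp add: asymptote_def c_def algebra_simps)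
  moreover have "0 \<le> c * ((c - 1) / 2)" "c * ((c - 1) / 2) \<le> c * c" "0 \<le> c * c"
    using c by (auto intro!: mult_left_mono)
  ultimately have "\<bar>N t - asymptote t\<bar> \<le> c * c + c"
    using N c by linarith
  then show ?thesis by (simp add: c_def algebra_simps)
qed

lemma error_tendsto_0: "((\<lambda>t. N t - asymptote t) \<longlongrightarrow> 0) at_top"
proof (rule tendsto_0_if_contracting)
  have "1 \<le> exp 1 - (1::real)" using exp_1_ge_2 by simp
  then have "1 \<le> (exp 1 - (1::real))^2" by simp
  then show "0 \<le> 1 - 1 / (exp 1 - (1::real))^2" "1 - 1 / (exp 1 - (1::real))^2 < 1"
    by simp_all
qed (use error_bounded error_contracts in auto)

end

theorem theorem14:
  fixes M :: "'a measure" and Z :: "nat \<Rightarrow> 'a \<Rightarrow> real"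
  assumes "prob_space M"
    and "iid_uniform M Z 1 (exp 1)"
  shows "(\<lambda>t::real. expected_selections M Z t - (exp 1 - 1) * (t + (exp 1 - 2) / 2)) \<in> o[at_top](\<lambda>_. 1)"
proof -
  interpret uniform_selections M Z
    using assms by (intro uniform_selections.intro uniform_selections_axioms.intro)
  have "((\<lambda>t. expected_selections M Z t - (exp 1 - 1) * (t + (exp 1 - 2) / 2)) \<longlongrightarrow> 0) at_top"
  proof (rule Lim_transform_eventually[OF error_tendsto_0])
    show "\<forall>\<^sub>F t in at_top. N t - asymptote t
        = expected_selections M Z t - (exp 1 - 1) * (t + (exp 1 - 2) / 2)"
      by (rule eventually_at_top_linorderI[of 0])
        (simp add: expected_selections_eq_U N_def asymptote_def)
  qed
  then show ?thesis by (intro smalloI_tendsto) simp_all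
qed

end
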